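(* Let $D\in\mathbb{N}$, let $\xi_1,\xi_2,\ldots,\xi_D$ be independent real-valued random variables, and let $\eta$ be a counting random variable independent of $\{\xi_1,\xi_2,\ldots,\xi_D\}$. Suppose that the following conditions are satisfied: (a) $\mathbb{P}(\eta\leqslant D)=1$; (b) $F_{\xi_1}\in\mathcal{C}$; (c) for each $k=2,\ldots,D$, either $F_{\xi_k}\in\mathcal{C}$ or $\overline{F}_{\xi_k}(x)=o\left(\overline{F}_{\xi_1}(x)\right)$ as $x\to\infty$. Then the distribution function $F_{S_\eta}$ of the randomly stopped sum $S_\eta$ belongs to the class $\mathcal{C}$.
   Context: For a random variable $X$, $F_X(x)=\mathbb{P}(X\leqslant x)$ denotes its distribution function (d.f.), and for a d.f. $F$, $\overline{F}(x)=1-F(x)$ for real $x$. A counting random variable is an integer-valued, nonnegative random variable that is nondegenerate at zero (i.e. $\mathbb{P}(\eta=0)<1$). Put $S_0=0$, $S_n=\xi_1+\cdots+\xi_n$ for $n\geqslant 1$, and $S_\eta=\sum_{k=1}^{\eta}\xi_k$, so that $F_{S_\eta}(x)=\sum_{n\geqslant 0}\mathbb{P}(\eta=n)\mathbb{P}(S_n\leqslant x)$ (here only $n\leqslant D$ contribute). Class $\mathcal{C}$: a d.f. $F$ on $\mathbb{R}$ (with $\overline{F}(x)>0$ for all $x$, so that the ratio is defined) has a consistently varying tail, written $F\in\mathcal{C}$, if $$\lim_{y\uparrow1}\limsup_{x\to\infty}\frac{\overline{F}(xy)}{\overline{F}(x)}=1.$$ The notation $f(x)=o(g(x))$ means $\lim_{x\to\infty}f(x)/g(x)=0$.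 *)

theory Defs
  imports "HOL-Probability.Probability" "HOL-Library.Landau_Symbols"
begin

definition dist_fun :: "'a measure \<Rightarrow> ('a \<Rightarrow> real) \<Rightarrow> real \<Rightarrow> real" where
  "dist_fun M X = cdf (distr M borel X)"

definition is_dist_fun :: "(real \<Rightarrow> real) \<Rightarrow> bool" where
  "is_dist_fun F \<longleftrightarrow> (\<exists>N. real_distribution N \<and> F = cdf N)"

definition tail :: "(real \<Rightarrow> real) \<Rightarrow> real \<Rightarrow> real" where
  "tail F x = 1 - F x"

text \<open>The upper limit is taken in the extended reals, since the ratio need not be bounded.\<close>

definition class_C :: "(real \<Rightarrow> real) set" where
  "class_C = {F. is_dist_fun F \<and> (\<forall>x. tail F x > 0) \<and>
     ((\<lambda>y. Limsup at_top (\<lambda>x. ereal (tail F (x * y) / tail F x))) \<longlongrightarrow> 1) (at_left 1)}"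

definition counting_rv :: "'a measure \<Rightarrow> ('a \<Rightarrow> nat) \<Rightarrow> bool" where
  "counting_rv M \<eta> \<longleftrightarrow>
     \<eta> \<in> measurable M (count_space UNIV) \<and> measure M {\<omega> \<in> space M. \<eta> \<omega> = 0} < 1"

definition partial_sum :: "(nat \<Rightarrow> 'a \<Rightarrow> real) \<Rightarrow> nat \<Rightarrow> 'a \<Rightarrow> real" where
  "partial_sum \<xi> n \<omega> = (\<Sum>k=1..n. \<xi> k \<omega>)"

text \<open>
  Only the summands with index at most \<open>D\<close> exist, and the event \<open>\<eta> > D\<close> has probability zero.
  The cutoff makes the sum well defined (and measurable) on that event too; it does not
  change the distribution, see \<open>AE_stopped_sum\<close> and \<open>dist_fun_stopped_sum\<close> below.
\<close>

definition stopped_sum :: "nat \<Rightarrow> (nat \<Rightarrow> 'a \<Rightarrow> real) \<Rightarrow> ('a \<Rightarrow> nat) \<Rightarrow> 'a \<Rightarrow> real" where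
  "stopped_sum D \<xi> \<eta> \<omega> = partial_sum \<xi> (min (\<eta> \<omega>) D) \<omega>"

text \<open>
  The whole family enters as one random element of the product space, so that \<open>\<eta>\<close> is independent
  of all the \<open>\<xi> k\<close> jointly. The library constant \<^const>\<open>prob_space.indep_var\<close> requires both random
  variables to have the same value type; the following is what it unfolds to, up to measurability.
\<close>

definition indep_of_family ::
    "'a measure \<Rightarrow> ('a \<Rightarrow> nat) \<Rightarrow> (nat \<Rightarrow> 'a \<Rightarrow> real) \<Rightarrow> nat set \<Rightarrow> bool" where
  "indep_of_family M \<eta> \<xi> I \<longleftrightarrow>
     prob_space.indep_set M
       {\<eta> -` A \<inter> space M | A. A \<in> sets (count_space UNIV)}
       {(\<lambda>\<omega>. restrict (\<lambda>k. \<xi> k \<omega>) I) -` B \<inter> space M | B. B \<in> sets (PiM I (\<lambda>_. borel))}"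

context prob_space
begin

lemma AE_stopped_sum:
  assumes "\<eta> \<in> measurable M (count_space UNIV)" "prob {\<omega> \<in> space M. \<eta> \<omega> \<le> D} = 1"
  shows "AE \<omega> in M. stopped_sum D \<xi> \<eta> \<omega> = (\<Sum>k=1..\<eta> \<omega>. \<xi> k \<omega>)"
proof -
  have "AE \<omega> in M. \<eta> \<omega> \<le> D"
    using assms by (subst (asm) prob_Collect_eq_1) auto
  then show ?thesis
    by eventually_elim (simp add: stopped_sum_def partial_sum_def min_def)
qed

lemma dist_fun_stopped_sum:
  assumes eta [measurable]: "\<eta> \<in> measurable M (count_space UNIV)"
    and xi: "\<And>k. k \<in> {1..D} \<Longrightarrow> \<xi> k \<in> borel_measurable M"
    and ind: "indep_of_family M \<eta> \<xi> {1..D}"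
    and D: "prob {\<omega> \<in> space M. \<eta> \<omega> \<le> D} = 1"
  shows "dist_fun M (stopped_sum D \<xi> \<eta>) x =
    (\<Sum>n\<le>D. prob {\<omega> \<in> space M. \<eta> \<omega> = n} * prob {\<omega> \<in> space M. partial_sum \<xi> n \<omega> \<le> x})"
proof -
  let ?P = "PiM {1..D} (\<lambda>_. borel) :: (nat \<Rightarrow> real) measure"
  let ?Y = "\<lambda>\<omega>. restrict (\<lambda>k. \<xi> k \<omega>) {1..D}"
  have ps [measurable]: "partial_sum \<xi> n \<in> borel_measurable M" if "n \<le> D" for n
    unfolding partial_sum_def using that by (intro borel_measurable_sum xi) auto
  have ss [measurable]: "stopped_sum D \<xi> \<eta> \<in> borel_measurable M"
  proof -
    have "(\<lambda>\<omega>. (\<lambda>n \<omega>. partial_sum \<xi> (min n D) \<omega>) (\<eta> \<omega>) \<omega>) \<in> borel_measurable M"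
      by (rule measurable_compose_countable[OF ps]) auto
    then show ?thesis by (simp add: stopped_sum_def [abs_def])
  qed
  let ?A = "\<lambda>n. {\<omega> \<in> space M. \<eta> \<omega> = n \<and> partial_sum \<xi> n \<omega> \<le> x}"
  have A: "?A n \<in> events" if "n \<le> D" for n
    using ps[OF that] by measurable
  have AE: "AE \<omega> in M. \<eta> \<omega> \<le> D"
    using D by (subst (asm) prob_Collect_eq_1) auto
  have "dist_fun M (stopped_sum D \<xi> \<eta>) x = prob {\<omega> \<in> space M. stopped_sum D \<xi> \<eta> \<omega> \<le> x}"
    unfolding dist_fun_def cdf_def by (subst measure_distr) (auto intro!: arg_cong[where f = prob])
  also have "\<dots> = prob (\<Union>n\<in>{..D}. ?A n)"
  proof (rule finite_measure_eq_AE)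
    show "AE \<omega> in M. (\<omega> \<in> {\<omega> \<in> space M. stopped_sum D \<xi> \<eta> \<omega> \<le> x}) = (\<omega> \<in> (\<Union>n\<in>{..D}. ?A n))"
      using AE by eventually_elim (auto simp: stopped_sum_def min_def)
  qed (use A in auto)
  also have "\<dots> = (\<Sum>n\<le>D. prob (?A n))"
    using A by (intro finite_measure_finite_Union) (auto simp: disjoint_family_on_def)
  also have "\<dots> = (\<Sum>n\<le>D. prob {\<omega> \<in> space M. \<eta> \<omega> = n} * prob {\<omega> \<in> space M. partial_sum \<xi> n \<omega> \<le> x})"
  proof (rule sum.cong)
    fix n assume "n \<in> {..D}"
    then have n: "n \<le> D" by simp
    let ?B = "{f \<in> space ?P. (\<Sum>k=1..n. f k) \<le> x}"
    have meas: "(\<lambda>f. \<Sum>k=1..n. f k) \<in> borel_measurable ?P"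
      using n by (intro borel_measurable_sum measurable_component_singleton) auto
    have B: "?B \<in> sets ?P" using meas by measurable
    have eq: "(\<Sum>k=1..n. ?Y \<omega> k) = partial_sum \<xi> n \<omega>" for \<omega>
      unfolding partial_sum_def using n by (intro sum.cong) auto
    have mem: "?Y \<omega> \<in> ?B \<longleftrightarrow> partial_sum \<xi> n \<omega> \<le> x" for \<omega>
      using eq[of \<omega>] by (auto simp: space_PiM)
    have "prob ((\<eta> -` {n} \<inter> space M) \<inter> (?Y -` ?B \<inter> space M)) =
        prob (\<eta> -` {n} \<inter> space M) * prob (?Y -` ?B \<inter> space M)"
      using ind unfolding indep_of_family_def by (rule indep_setD) (force, use B in blast)
    moreover have "(\<eta> -` {n} \<inter> space M) \<inter> (?Y -` ?B \<inter> space M) = ?A n"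
      using mem by blast
    moreover have "\<eta> -` {n} \<inter> space M = {\<omega> \<in> space M. \<eta> \<omega> = n}" by auto
    moreover have "?Y -` ?B \<inter> space M = {\<omega> \<in> space M. partial_sum \<xi> n \<omega> \<le> x}"
      using mem by blast
    ultimately show "prob (?A n) =
        prob {\<omega> \<in> space M. \<eta> \<omega> = n} * prob {\<omega> \<in> space M. partial_sum \<xi> n \<omega> \<le> x}" by simp
  qed simp
  finally show ?thesis .
qed

end

end

theory Submission
  imports Defs
begin

text \<open>
  A sum of independent heavy-tailed variables is large essentially only because one of them is.
  If \<open>X\<close> and \<open>Y\<close> are independent and the sum \<open>h\<close> of their two tails varies consistently, then
  \<open>P(X + Y > x)\<close> is asymptotically equivalent to \<open>h x\<close> (\<open>tail_sum_asymp_equiv\<close>): when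
  \<open>X + Y\<close> exceeds \<open>x\<close>, either one variable exceeds almost all of \<open>x\<close>, or both exceed a fixed
  fraction of \<open>x\<close>. The first alternative costs no more than \<open>h\<close> at a point close to \<open>x\<close>, which
  consistent variation compares with \<open>h x\<close>; by independence the second has a probability of
  smaller order. The hypothesis on \<open>h\<close> covers both alternatives of the theorem at once: \<open>h\<close> varies
  consistently if both tails do, and also if one does and the other is negligible against it.

  Consistent variation of a function at infinity is inherited under asymptotic equivalence, so
  induction on \<open>n \<ge> 1\<close> shows that the tail of \<open>S\<^sub>n\<close> varies consistently. The induction also carries
  that the tail of \<open>\<xi>\<^sub>1\<close> is \<open>O\<close> of the tail of \<open>S\<^sub>n\<close>, so that a summand negligible against \<open>\<xi>\<^sub>1\<close>
  remains negligible against \<open>S\<^sub>n\<close> (\<open>consistently_varying_tail_partial_sum\<close>). Finally, the tail of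
  the stopped sum is the mixture of the tails of the \<open>S\<^sub>n\<close> with weights \<open>P(\<eta> = n)\<close>, and consistent
  variation passes to nonnegative linear combinations. Positivity of the mixture
  comes from any \<open>n \<ge> 1\<close> of positive weight, since the tail of such an \<open>S\<^sub>n\<close> dominates the positive
  tail of \<open>\<xi>\<^sub>1\<close>.
\<close>

section \<open>Consistent variation of functions at infinity\<close>

text \<open>
  The condition on the tail in \<^const>\<open>class_C\<close>, in a form without division. It makes sense for
  functions that vanish or are not monotone, and each closure property reduces to combining
  inequalities that hold eventually, first in \<open>y\<close> and then in \<open>x\<close>.
\<close>

definition consistently_varying :: "(real \<Rightarrow> real) \<Rightarrow> bool" where
  "consistently_varying f \<longleftrightarrow>
     (\<forall>\<epsilon>>0. \<forall>\<^sub>F y in at_left 1. \<forall>\<^sub>F x in at_top. f (x * y) \<le> (1 + \<epsilon>) * f x)"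

lemma consistently_varyingI:
  assumes "\<And>\<epsilon>. 0 < \<epsilon> \<Longrightarrow> \<forall>\<^sub>F y in at_left 1. \<forall>\<^sub>F x in at_top. f (x * y) \<le> (1 + \<epsilon>) * f x"
  shows "consistently_varying f"
  using assms unfolding consistently_varying_def by blast

lemma consistently_varyingD:
  assumes "consistently_varying f" "0 < \<epsilon>"
  shows "\<forall>\<^sub>F y in at_left 1. \<forall>\<^sub>F x in at_top. f (x * y) \<le> (1 + \<epsilon>) * f x"
  using assms unfolding consistently_varying_def by blast

lemma eventually_at_left_1_unit: "\<forall>\<^sub>F y in at_left (1::real). 0 < y \<and> y < 1"
  using eventually_at_left_real[of 0 1] by (auto elim: eventually_mono)

lemma consistently_varying_factor:
  assumes "consistently_varying f" "0 < \<epsilon>"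
  obtains y where "0 < y" "y < 1" "\<forall>\<^sub>F x in at_top. f (x * y) \<le> (1 + \<epsilon>) * f x"
  using eventually_happens'[OF _ eventually_conj[OF eventually_at_left_1_unit
      consistently_varyingD[OF assms]]]
  by (auto simp: trivial_limit_at_left_real)

lemma eventually_at_top_scale:
  fixes y :: real
  assumes "0 < y" "\<forall>\<^sub>F x in at_top. P x"
  shows "\<forall>\<^sub>F x in at_top. P (x * y)"
proof -
  have "filterlim (\<lambda>x. x * y) at_top at_top"
    using assms(1) by (intro filterlim_at_top_mult_tendsto_pos[OF tendsto_const _ filterlim_ident]) 
  then show ?thesis
    using assms(2) unfolding filterlim_iff by blast
qed

text \<open>
  This makes the empty sum \<open>S\<^sub>0 = 0\<close> a harmless component of the mixture: its tail vanishes on the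
  nonnegative reals.
\<close>

lemma consistently_varying_zero:
  assumes "\<forall>\<^sub>F x in at_top. f x = 0"
  shows "consistently_varying f"
proof (rule consistently_varyingI)
  fix \<epsilon> :: real
  show "\<forall>\<^sub>F y in at_left 1. \<forall>\<^sub>F x in at_top. f (x * y) \<le> (1 + \<epsilon>) * f x"
    using eventually_at_left_1_unit
  proof eventually_elim
    case (elim y)
    then have "\<forall>\<^sub>F x in at_top. f (x * y) = 0"
      by (intro eventually_at_top_scale assms) auto
    with assms show ?case by eventually_elim simp
  qed
qed

lemma consistently_varying_add:
  assumes "consistently_varying f" "consistently_varying g"
  shows "consistently_varying (\<lambda>x. f x + g x)"
proof (rule consistently_varyingI)
  fix \<epsilon> :: real assume "0 < \<epsilon>"
  from consistently_varyingD[OF assms(1) this] consistently_varyingD[OF assms(2) this]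
  show "\<forall>\<^sub>F y in at_left 1. \<forall>\<^sub>F x in at_top. f (x * y) + g (x * y) \<le> (1 + \<epsilon>) * (f x + g x)"
  proof eventually_elim
    case (elim y)
    then show ?case by eventually_elim (simp add: algebra_simps)
  qed
qed

lemma consistently_varying_cmult:
  assumes "consistently_varying f" "0 \<le> c"
  shows "consistently_varying (\<lambda>x. c * f x)"
proof (rule consistently_varyingI)
  fix \<epsilon> :: real assume "0 < \<epsilon>"
  from consistently_varyingD[OF assms(1) this]
  show "\<forall>\<^sub>F y in at_left 1. \<forall>\<^sub>F x in at_top. c * f (x * y) \<le> (1 + \<epsilon>) * (c * f x)"
  proof eventually_elim
    case (elim y)
    then show ?case
      by eventually_elim (use assms(2) in \<open>auto dest: mult_left_mono simp: mult.left_commute\<close>)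
  qed
qed

lemma consistently_varying_sum:
  assumes "\<And>i. i \<in> I \<Longrightarrow> consistently_varying (f i)"
  shows "consistently_varying (\<lambda>x. \<Sum>i\<in>I. f i x)"
  using assms
  by (induction I rule: infinite_finite_induct)
     (auto intro: consistently_varying_zero consistently_varying_add)

lemma asymp_equiv_imp_eventually_le:
  fixes f g :: "real \<Rightarrow> real"
  assumes "f \<sim>[at_top] g" "0 < e" "\<And>x. 0 \<le> g x"
  shows "\<forall>\<^sub>F x in at_top. f x \<le> (1 + e) * g x"
proof -
  have "(\<lambda>x. f x - g x) \<in> o(g)"
    using assms(1) by (simp add: asymp_equiv_altdef)
  from landau_o.smallD[OF this assms(2)] show ?thesis
    by eventually_elim (use assms(3) in \<open>auto simp: algebra_simps abs_le_iff\<close>)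
qed

text \<open>
  Passing from \<open>g (x * y)\<close> to \<open>f (x * y)\<close>, on to \<open>f x\<close> and back to \<open>g x\<close> loses a factor \<open>1 + e\<close>
  three times.
\<close>

lemma consistently_varying_asymp_equiv:
  assumes "f \<sim>[at_top] g" "consistently_varying f" "\<And>x. 0 \<le> f x" "\<And>x. 0 \<le> g x"
  shows "consistently_varying g"
proof (rule consistently_varyingI)
  fix \<epsilon> :: real assume \<epsilon>: "0 < \<epsilon>"
  \<comment> \<open>For \<open>e \<le> 1\<close> the cube of \<open>1 + e\<close> is at most \<open>1 + (3 + 3 + 1) * e\<close>.\<close>
  define e where "e = min 1 (\<epsilon> / 7)"
  have e: "0 < e" "e \<le> 1" "7 * e \<le> \<epsilon>" using \<epsilon> by (auto simp: e_def)
  have "e * e \<le> e" "e * (e * e) \<le> e"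
    using e by (auto intro: mult_left_le mult_le_one)
  moreover have "(1 + e) * ((1 + e) * (1 + e)) = 1 + 3 * e + 3 * (e * e) + e * (e * e)"
    by (simp add: algebra_simps)
  ultimately have cube: "(1 + e) * ((1 + e) * (1 + e)) \<le> 1 + \<epsilon>"
    using e by linarith
  have fg: "\<forall>\<^sub>F x in at_top. f x \<le> (1 + e) * g x"
    using assms e by (intro asymp_equiv_imp_eventually_le) auto
  have gf: "\<forall>\<^sub>F x in at_top. g x \<le> (1 + e) * f x"
    by (rule asymp_equiv_imp_eventually_le[OF asymp_equiv_symI[OF assms(1)] e(1) assms(3)])
  from consistently_varyingD[OF assms(2) e(1)] eventually_at_left_1_unit
  show "\<forall>\<^sub>F y in at_left 1. \<forall>\<^sub>F x in at_top. g (x * y) \<le> (1 + \<epsilon>) * g x"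
  proof eventually_elim
    case (elim y)
    from elim(2) have "\<forall>\<^sub>F x in at_top. g (x * y) \<le> (1 + e) * f (x * y)"
      by (intro eventually_at_top_scale[OF _ gf]) auto
    with elim(1) fg show ?case
    proof eventually_elim
      case (elim x)
      have "g (x * y) \<le> (1 + e) * ((1 + e) * ((1 + e) * g x))"
        using elim e by (meson order_trans mult_left_mono add_nonneg_nonneg less_imp_le zero_le_one)
      also have "\<dots> = ((1 + e) * ((1 + e) * (1 + e))) * g x" by (simp only: mult.assoc)
      also have "\<dots> \<le> (1 + \<epsilon>) * g x" using cube assms(4) by (rule mult_right_mono)
      finally show ?case .
    qed
  qed
qed

lemma consistently_varying_add_smallo:
  assumes "consistently_varying f" "g \<in> o(f)" "\<And>x. 0 \<le> f x" "\<And>x. 0 \<le> g x"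
  shows "consistently_varying (\<lambda>x. f x + g x)"
proof (rule consistently_varying_asymp_equiv[OF _ assms(1)])
  show "f \<sim>[at_top] (\<lambda>x. f x + g x)"
    using assms(2) by (subst asymp_equiv_sym) (simp add: asymp_equiv_altdef)
qed (use assms in \<open>auto intro: add_nonneg_nonneg\<close>)

text \<open>
  Consistent variation controls factors close to 1 only; iterating one such factor \<open>y\<close> until
  \<open>y ^ n < d\<close> controls an arbitrary positive factor \<open>d\<close>, at the price of a large constant.
\<close>

lemma consistently_varying_imp_dominated:
  assumes f: "consistently_varying f" and anti: "antimono f" and d: "0 < d"
  shows "\<exists>C>0. \<forall>\<^sub>F x in at_top. f (x * d) \<le> C * f x"
proof -
  obtain y where y: "0 < y" "y < 1" and ev: "\<forall>\<^sub>F x in at_top. f (x * y) \<le> (1 + 1) * f x"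
    using consistently_varying_factor[OF f zero_less_one] by blast
  have iter: "\<forall>\<^sub>F x in at_top. f (x * y ^ n) \<le> 2 ^ n * f x" for n
  proof (induction n)
    case (Suc n)
    have "\<forall>\<^sub>F x in at_top. f ((x * y ^ n) * y) \<le> (1 + 1) * f (x * y ^ n)"
      using y by (intro eventually_at_top_scale[OF _ ev]) auto
    with Suc.IH show ?case by eventually_elim (simp add: mult_ac)
  qed auto
  obtain n where n: "y ^ n < d"
    using real_arch_pow_inv[OF d y(2)] by blast
  from iter[of n] eventually_ge_at_top[of 0]
  have "\<forall>\<^sub>F x in at_top. f (x * d) \<le> 2 ^ n * f x"
  proof eventually_elim
    case (elim x)
    have "f (x * d) \<le> f (x * y ^ n)"
      using n elim by (intro antimonoD[OF anti] mult_left_mono) auto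
    with elim show ?case by linarith
  qed
  then show ?thesis by (intro exI[of _ "2 ^ n"]) auto
qed

section \<open>Tails of distribution functions\<close>

lemma is_dist_fun_tail:
  assumes "is_dist_fun F"
  shows "antimono (tail F)" "0 \<le> tail F x" "(tail F \<longlongrightarrow> 0) at_top"
    "(tail F \<longlongrightarrow> 1) at_bot"
proof -
  obtain N where N: "real_distribution N" and F: "F = cdf N"
    using assms unfolding is_dist_fun_def by blast
  interpret real_distribution N by (rule N)
  show "antimono (tail F)"
    by (auto simp: antimono_def tail_def F intro: cdf_nondecreasing)
  show "0 \<le> tail F x"
    using cdf_bounded_prob[of x] by (simp add: tail_def F)
  show "(tail F \<longlongrightarrow> 0) at_top" "(tail F \<longlongrightarrow> 1) at_bot"
    using tendsto_diff[OF tendsto_const cdf_lim_at_top_prob, of 1]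
      tendsto_diff[OF tendsto_const cdf_lim_at_bot, of 1]
    by (simp_all add: tail_def[abs_def] F)
qed

text \<open>
  A tail is decreasing, so for \<open>0 < y < 1\<close> the ratio in \<^const>\<open>class_C\<close> is at least 1 at all \<open>x \<ge> 0\<close>.
  Hence only the upper half of the limit statement has content, and that half is consistent
  variation.
\<close>

lemma class_C_iff_consistently_varying:
  "F \<in> class_C \<longleftrightarrow> is_dist_fun F \<and> (\<forall>x. 0 < tail F x) \<and> consistently_varying (tail F)"
proof -
  let ?R = "\<lambda>y x. tail F (x * y) / tail F x"
  let ?L = "\<lambda>y. Limsup at_top (\<lambda>x. ereal (?R y x))"
  have "(?L \<longlongrightarrow> 1) (at_left 1) \<longleftrightarrow> consistently_varying (tail F)"
    if F: "is_dist_fun F" and pos: "\<And>x. 0 < tail F x"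
  proof
    assume lim: "(?L \<longlongrightarrow> 1) (at_left 1)"
    show "consistently_varying (tail F)"
    proof (rule consistently_varyingI)
      fix \<epsilon> :: real assume "0 < \<epsilon>"
      then have "\<forall>\<^sub>F y in at_left 1. ?L y < ereal (1 + \<epsilon>)"
        by (intro order_tendstoD(2)[OF lim]) (simp add: one_ereal_def)
      then show "\<forall>\<^sub>F y in at_left 1. \<forall>\<^sub>F x in at_top. tail F (x * y) \<le> (1 + \<epsilon>) * tail F x"
      proof eventually_elim
        case (elim y)
        from Limsup_lessD[OF this] show ?case
          by eventually_elim (use pos in \<open>auto simp: divide_less_eq intro: less_imp_le\<close>)
      qed
    qed
  next
    assume cv: "consistently_varying (tail F)"
    show "(?L \<longlongrightarrow> 1) (at_left 1)"
    proof (rule order_tendstoI)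
      fix a :: ereal assume a: "a < 1"
      show "\<forall>\<^sub>F y in at_left 1. a < ?L y"
        using eventually_at_left_1_unit
      proof eventually_elim
        case (elim y)
        have "\<forall>\<^sub>F x in at_top. 1 \<le> ereal (?R y x)"
          using eventually_ge_at_top[of 0]
        proof eventually_elim
          case (elim x)
          have "tail F x \<le> tail F (x * y)"
            using \<open>0 < y \<and> y < 1\<close> elim
            by (intro antimonoD[OF is_dist_fun_tail(1)[OF F]]) (auto intro: mult_left_le)
          then show ?case using pos[of x] by (simp add: one_ereal_def le_divide_eq)
        qed
        then have "1 \<le> Liminf at_top (\<lambda>x. ereal (?R y x))"
          by (rule Liminf_bounded)
        also have "\<dots> \<le> ?L y"
          by (rule Liminf_le_Limsup) simp
        finally show ?case using a by (rule less_le_trans[rotated])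
      qed
    next
      fix a :: ereal assume "1 < a"
      then obtain b where b: "1 < ereal b" "ereal b < a"
        using ereal_dense2 by blast
      then have "0 < b - 1" by (simp add: one_ereal_def)
      from consistently_varyingD[OF cv this]
      show "\<forall>\<^sub>F y in at_left 1. ?L y < a"
      proof eventually_elim
        case (elim y)
        then have "\<forall>\<^sub>F x in at_top. ereal (?R y x) \<le> ereal b"
          by eventually_elim (use pos in \<open>simp add: divide_le_eq\<close>)
        then have "?L y \<le> ereal b" by (rule Limsup_bounded)
        with b(2) show ?case by (rule le_less_trans[rotated])
      qed
    qed
  qed
  then show ?thesis unfolding class_C_def by auto
qed

context prob_space
begin

lemma is_dist_fun_dist_fun:
  assumes "random_variable borel X"
  shows "is_dist_fun (dist_fun M X)"
  unfolding is_dist_fun_def dist_fun_def using real_distribution_distr[OF assms] by blast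

lemma dist_fun_eq:
  assumes [measurable]: "random_variable borel X"
  shows "dist_fun M X x = prob {\<omega> \<in> space M. X \<omega> \<le> x}"
  unfolding dist_fun_def cdf_def by (subst measure_distr) (auto intro!: arg_cong[where f = prob])

lemma tail_dist_fun_eq:
  assumes [measurable]: "random_variable borel X"
  shows "tail (dist_fun M X) x = prob {\<omega> \<in> space M. x < X \<omega>}"
proof -
  have "{\<omega> \<in> space M. x < X \<omega>} = space M - {\<omega> \<in> space M. X \<omega> \<le> x}" by auto
  moreover have "prob (space M - {\<omega> \<in> space M. X \<omega> \<le> x}) = 1 - prob {\<omega> \<in> space M. X \<omega> \<le> x}"
    by (intro prob_compl) measurable
  ultimately show ?thesis by (simp add: tail_def dist_fun_eq)
qed

section \<open>The sum of two independent variables\<close>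

lemma prob_joint_exceedance:
  assumes "indep_var borel X borel Y"
  shows "prob ({\<omega> \<in> space M. a < X \<omega>} \<inter> {\<omega> \<in> space M. b < Y \<omega>}) =
    tail (dist_fun M X) a * tail (dist_fun M Y) b"
proof -
  have "prob ((\<lambda>\<omega>. (X \<omega>, Y \<omega>)) -` ({a<..} \<times> {b<..}) \<inter> space M) =
      prob (X -` {a<..} \<inter> space M) * prob (Y -` {b<..} \<inter> space M)"
    using assms by (intro indep_varD) auto
  moreover have "(\<lambda>\<omega>. (X \<omega>, Y \<omega>)) -` ({a<..} \<times> {b<..}) \<inter> space M =
      {\<omega> \<in> space M. a < X \<omega>} \<inter> {\<omega> \<in> space M. b < Y \<omega>}" by auto
  moreover have "X -` {a<..} \<inter> space M = {\<omega> \<in> space M. a < X \<omega>}" for X :: "'a \<Rightarrow> real" and a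
    by auto
  ultimately show ?thesis
    using indep_var_rv1[OF assms] indep_var_rv2[OF assms] by (simp add: tail_dist_fun_eq)
qed

text \<open>
  If \<open>X + Y > x\<close> but neither variable exceeds \<open>x * y\<close>, then each has to contribute more than the
  remaining \<open>x * (1 - y)\<close>.
\<close>

lemma tail_sum_le:
  fixes x y :: real
  assumes ind: "indep_var borel X borel Y"
  defines "f \<equiv> tail (dist_fun M X)" and "g \<equiv> tail (dist_fun M Y)"
  shows "tail (dist_fun M (\<lambda>\<omega>. X \<omega> + Y \<omega>)) x
    \<le> f (x * y) + g (x * y) + f (x * (1 - y)) * g (x * (1 - y))"
proof -
  note [measurable] = indep_var_rv1[OF ind] indep_var_rv2[OF ind]
  let ?A = "\<lambda>a. {\<omega> \<in> space M. a < X \<omega>}" and ?B = "\<lambda>b. {\<omega> \<in> space M. b < Y \<omega>}"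
  let ?d = "x * (1 - y)"
  have "prob {\<omega> \<in> space M. x < X \<omega> + Y \<omega>} \<le> prob (?A (x * y) \<union> ?B (x * y) \<union> (?A ?d \<inter> ?B ?d))"
    by (intro finite_measure_mono) (auto simp: algebra_simps)
  also have "\<dots> \<le> prob (?A (x * y) \<union> ?B (x * y)) + prob (?A ?d \<inter> ?B ?d)"
    by (intro measure_Un_le) measurable
  also have "prob (?A (x * y) \<union> ?B (x * y)) \<le> prob (?A (x * y)) + prob (?B (x * y))"
    by (intro measure_Un_le) measurable
  finally show ?thesis
    by (simp add: f_def g_def tail_dist_fun_eq prob_joint_exceedance[OF ind])
qed

text \<open>
  One variable above \<open>z\<close> pushes the sum above \<open>x\<close> unless the other lies below \<open>x - z\<close>. The two
  events obtained in this way overlap only where both variables exceed \<open>z\<close>, which accounts for the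
  subtracted product. The bound is used with \<open>z\<close> slightly larger than \<open>x\<close>, so that \<open>x - z\<close> tends
  to minus infinity.
\<close>

lemma tail_sum_ge:
  fixes x z :: real
  assumes ind: "indep_var borel X borel Y"
  defines "f \<equiv> tail (dist_fun M X)" and "g \<equiv> tail (dist_fun M Y)"
  shows "f z * g (x - z) + g z * f (x - z) - f z * g z
    \<le> tail (dist_fun M (\<lambda>\<omega>. X \<omega> + Y \<omega>)) x"
proof -
  note [measurable] = indep_var_rv1[OF ind] indep_var_rv2[OF ind]
  let ?A = "\<lambda>a. {\<omega> \<in> space M. a < X \<omega>}" and ?B = "\<lambda>b. {\<omega> \<in> space M. b < Y \<omega>}"
  let ?E = "?A z \<inter> ?B (x - z)" and ?F = "?A (x - z) \<inter> ?B z"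
  have "prob ?E + prob ?F = prob (?E \<union> ?F) + prob (?E \<inter> ?F)"
    by (subst measure_Un3) (auto simp: fmeasurable_eq_sets)
  also have "prob (?E \<union> ?F) \<le> prob {\<omega> \<in> space M. x < X \<omega> + Y \<omega>}"
    by (intro finite_measure_mono) auto
  also have "prob (?E \<inter> ?F) \<le> prob (?A z \<inter> ?B z)"
    by (intro finite_measure_mono) auto
  finally show ?thesis
    by (simp add: f_def g_def tail_dist_fun_eq prob_joint_exceedance[OF ind] mult.commute)
qed

text \<open>
  The principle of a single big jump. The product in \<open>tail_sum_le\<close> is negligible because one factor
  is of the order of \<open>h x\<close> by dominated variation while the other tends to 0. In \<open>tail_sum_ge\<close> the
  factors at \<open>x - z\<close> tend to 1 and the product tends to 0 relative to \<open>h z\<close>. In both bounds,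
  consistent variation moves the argument back to \<open>x\<close>.
\<close>

lemma tail_sum_asymp_equiv:
  assumes ind: "indep_var borel X borel Y"
  defines "f \<equiv> tail (dist_fun M X)" and "g \<equiv> tail (dist_fun M Y)"
  assumes cv: "consistently_varying (\<lambda>x. f x + g x)"
  shows "tail (dist_fun M (\<lambda>\<omega>. X \<omega> + Y \<omega>)) \<sim>[at_top] (\<lambda>x. f x + g x)"
proof -
  note [measurable] = indep_var_rv1[OF ind] indep_var_rv2[OF ind]
  define h where "h = (\<lambda>x. f x + g x)"
  define t where "t = tail (dist_fun M (\<lambda>\<omega>. X \<omega> + Y \<omega>))"
  have cv_h: "consistently_varying h" using cv by (simp add: h_def)
  have f: "antimono f" "\<And>x. 0 \<le> f x" "(f \<longlongrightarrow> 0) at_top" "(f \<longlongrightarrow> 1) at_bot"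
    unfolding f_def by (intro is_dist_fun_tail is_dist_fun_dist_fun; measurable)+
  have g: "antimono g" "\<And>x. 0 \<le> g x" "(g \<longlongrightarrow> 0) at_top" "(g \<longlongrightarrow> 1) at_bot"
    unfolding g_def by (intro is_dist_fun_tail is_dist_fun_dist_fun; measurable)+
  have anti_h: "antimono h"
    using f(1) g(1) by (auto simp: h_def antimono_def intro: add_mono)
  have h0: "0 \<le> h x" for x using f(2) g(2) by (simp add: h_def)
  have upper: "\<forall>\<^sub>F x in at_top. t x \<le> (1 + \<epsilon>) * h x" if \<epsilon>: "0 < \<epsilon>" for \<epsilon>
  proof -
    obtain y where y: "0 < y" "y < 1" and main: "\<forall>\<^sub>F x in at_top. h (x * y) \<le> (1 + \<epsilon> / 2) * h x"
      using consistently_varying_factor[OF cv_h half_gt_zero[OF \<epsilon>]] by blast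
    from y obtain C where C: "C > 0" "\<forall>\<^sub>F x in at_top. h (x * (1 - y)) \<le> C * h x"
      using consistently_varying_imp_dominated[OF cv_h anti_h, of "1 - y"] by (meson diff_gt_0_iff_gt)
    have "\<forall>\<^sub>F x in at_top. g x < \<epsilon> / (2 * C)"
      using \<epsilon> C by (intro order_tendstoD(2)[OF g(3)]) auto
    then have "\<forall>\<^sub>F x in at_top. g (x * (1 - y)) < \<epsilon> / (2 * C)"
      using y by (intro eventually_at_top_scale) auto
    with main C(2) show ?thesis
    proof eventually_elim
      case (elim x)
      let ?d = "x * (1 - y)"
      have "f ?d * g ?d \<le> (C * h x) * (\<epsilon> / (2 * C))"
        using elim f(2)[of ?d] g(2)[of ?d] by (intro mult_mono) (auto simp: h_def)
      also have "\<dots> = \<epsilon> / 2 * h x" using C(1) by simp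
      finally have "f ?d * g ?d \<le> \<epsilon> / 2 * h x" .
      moreover have "t x \<le> h (x * y) + f ?d * g ?d"
        using tail_sum_le[OF ind, of x y] by (simp add: t_def h_def f_def g_def)
      ultimately show ?case using elim(1) by (simp add: algebra_simps)
    qed
  qed
  have lower: "\<forall>\<^sub>F x in at_top. (1 - \<epsilon>) * h x \<le> t x" if \<epsilon>: "0 < \<epsilon>" for \<epsilon>
  proof -
    \<comment> \<open>The bound reached below is \<open>(1 - 2 * e) / (1 + e) \<ge> 1 - 3 * e\<close>.\<close>
    define e where "e = min (1 / 3) (\<epsilon> / 3)"
    have e: "0 < e" "3 * e \<le> 1" "3 * e \<le> \<epsilon>" using \<epsilon> by (auto simp: e_def)
    obtain y where y: "0 < y" "y < 1" and main: "\<forall>\<^sub>F z in at_top. h (z * y) \<le> (1 + e) * h z"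
      using consistently_varying_factor[OF cv_h e(1)] by blast
    \<comment> \<open>Parametrised by the larger point \<open>z\<close>, the level of interest is \<open>x = z * y\<close>.\<close>
    have bot: "filterlim (\<lambda>z. z * y - z) at_bot at_top"
    proof -
      have "filterlim (\<lambda>z. (y - 1) * z) at_bot at_top"
        using y by (intro filterlim_tendsto_neg_mult_at_bot[OF tendsto_const _ filterlim_ident]) auto
      then show ?thesis by (simp add: algebra_simps)
    qed
    have "\<forall>\<^sub>F z in at_top. 1 - e < f (z * y - z)"
      using e by (intro order_tendstoD(1)[OF filterlim_compose[OF f(4) bot]]) auto
    moreover have "\<forall>\<^sub>F z in at_top. 1 - e < g (z * y - z)"
      using e by (intro order_tendstoD(1)[OF filterlim_compose[OF g(4) bot]]) auto
    moreover have "\<forall>\<^sub>F z in at_top. f z < e"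
      using e by (intro order_tendstoD(2)[OF f(3)]) auto
    ultimately have "\<forall>\<^sub>F z in at_top. (1 - \<epsilon>) * h (z * y) \<le> t (z * y)"
      using main
    proof eventually_elim
      case (elim z)
      have t: "f z * g (z * y - z) + g z * f (z * y - z) - f z * g z \<le> t (z * y)"
        using tail_sum_ge[OF ind, of z "z * y"] by (simp add: t_def f_def g_def)
      have "f z * (1 - e) \<le> f z * g (z * y - z)" "g z * (1 - e) \<le> g z * f (z * y - z)"
        "f z * g z \<le> e * g z" "0 \<le> e * f z"
        using elim e f(2) g(2) by (auto intro!: mult_left_mono mult_right_mono)
      with t have "(1 - 2 * e) * h z \<le> t (z * y)"
        by (simp add: h_def algebra_simps)
      moreover have "(1 - 3 * e) * (1 + e) \<le> 1 - 2 * e"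
        using e by (simp add: algebra_simps)
      from mult_right_mono[OF this h0[of z]]
      have "(1 - 3 * e) * ((1 + e) * h z) \<le> (1 - 2 * e) * h z" by (simp only: mult.assoc)
      moreover have "(1 - 3 * e) * h (z * y) \<le> (1 - 3 * e) * ((1 + e) * h z)"
        using elim e by (intro mult_left_mono) auto
      moreover have "(1 - \<epsilon>) * h (z * y) \<le> (1 - 3 * e) * h (z * y)"
        using e h0 by (intro mult_right_mono) auto
      ultimately show ?case by linarith
    qed
    from eventually_at_top_scale[OF _ this, of "1 / y"] y show ?thesis by simp
  qed
  have "(\<lambda>x. t x - h x) \<in> o(h)"
  proof (rule landau_o.smallI)
    fix c :: real assume "0 < c"
    from upper[OF this] lower[OF this]
    show "\<forall>\<^sub>F x in at_top. norm (t x - h x) \<le> c * norm (h x)"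
      by eventually_elim (use h0 in \<open>auto simp: abs_le_iff algebra_simps\<close>)
  qed
  then show ?thesis by (simp add: asymp_equiv_altdef t_def h_def)
qed

section \<open>Partial sums and the randomly stopped sum\<close>

text \<open>
  The second conclusion is what lets the induction treat a summand whose tail is negligible against
  that of \<open>\<xi> 1\<close>; it also shows that the tail of the partial sum does not vanish.
\<close>

lemma consistently_varying_tail_partial_sum:
  assumes ind: "indep_vars (\<lambda>_. borel) \<xi> {1..D}"
    and C: "dist_fun M (\<xi> 1) \<in> class_C"
    and alt: "\<And>k. k \<in> {2..D} \<Longrightarrow> dist_fun M (\<xi> k) \<in> class_C \<or>
           tail (dist_fun M (\<xi> k)) \<in> o(tail (dist_fun M (\<xi> 1)))"
    and n: "1 \<le> n" "n \<le> D"
  shows "consistently_varying (tail (dist_fun M (partial_sum \<xi> n))) \<and>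
    tail (dist_fun M (\<xi> 1)) \<in> O(tail (dist_fun M (partial_sum \<xi> n)))"
  using n
proof (induction n rule: nat_induct_at_least)
  case base
  have "partial_sum \<xi> 1 = \<xi> 1" by (simp add: partial_sum_def fun_eq_iff)
  with C show ?case by (simp add: class_C_iff_consistently_varying)
next
  case (Suc n)
  define f where "f = tail (dist_fun M (\<xi> 1))"
  define t where "t = tail (dist_fun M (partial_sum \<xi> n))"
  define g where "g = tail (dist_fun M (\<xi> (Suc n)))"
  define t' where "t' = tail (dist_fun M (partial_sum \<xi> (Suc n)))"
  have IH: "consistently_varying t" "f \<in> O(t)"
    using Suc by (auto simp: t_def f_def)
  have "indep_var borel (\<xi> (Suc n)) borel (\<lambda>\<omega>. \<Sum>k\<in>{1..n}. \<xi> k \<omega>)"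
    using Suc.prems by (intro indep_vars_sum indep_vars_subset[OF ind]) auto
  then have step: "indep_var borel (\<xi> (Suc n)) borel (partial_sum \<xi> n)"
    by (simp add: partial_sum_def[abs_def])
  note rv = indep_var_rv1[OF step] indep_var_rv2[OF step]
  have t0: "0 \<le> t x" and g0: "0 \<le> g x" for x
    unfolding t_def g_def by (intro is_dist_fun_tail is_dist_fun_dist_fun rv)+
  have sum: "(\<lambda>\<omega>. \<xi> (Suc n) \<omega> + partial_sum \<xi> n \<omega>) = partial_sum \<xi> (Suc n)"
    by (simp add: partial_sum_def fun_eq_iff)
  have "random_variable borel (partial_sum \<xi> (Suc n))"
    unfolding sum[symmetric] by (intro borel_measurable_add rv)
  then have t'0: "0 \<le> t' x" for x
    unfolding t'_def by (intro is_dist_fun_tail is_dist_fun_dist_fun)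
  have cv: "consistently_varying (\<lambda>x. t x + g x)"
  proof (cases "dist_fun M (\<xi> (Suc n)) \<in> class_C")
    case True
    then show ?thesis using IH(1)
      by (intro consistently_varying_add) (auto simp: g_def class_C_iff_consistently_varying)
  next
    case False
    with alt[of "Suc n"] Suc have "g \<in> o(f)" by (auto simp: g_def f_def)
    also note IH(2)
    finally show ?thesis
      using IH(1) t0 g0 by (intro consistently_varying_add_smallo)
  qed
  then have equiv: "t' \<sim>[at_top] (\<lambda>x. t x + g x)"
    using tail_sum_asymp_equiv[OF step] by (simp add: sum t'_def t_def g_def add.commute[of "tail (dist_fun M (\<xi> (Suc n))) _"])
  have "consistently_varying t'"
    by (rule consistently_varying_asymp_equiv[OF asymp_equiv_symI[OF equiv] cv])
       (use t0 g0 t'0 in auto)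
  moreover have "t \<in> O(\<lambda>x. t x + g x)"
    using t0 g0 by (intro bigoI[of _ 1] always_eventually) auto
  then have "t \<in> O(t')"
    using bigthetaD1[OF asymp_equiv_imp_bigtheta[OF asymp_equiv_symI[OF equiv]]]
    by (rule landau_o.big_trans)
  with IH(2) have "f \<in> O(t')" by (rule landau_o.big_trans)
  ultimately show ?case by (simp add: f_def t'_def)
qed

end

theorem theorem5:
  fixes M :: "'a measure" and D :: nat
    and \<xi> :: "nat \<Rightarrow> 'a \<Rightarrow> real" and \<eta> :: "'a \<Rightarrow> nat"
  assumes "prob_space M"
    and "D \<ge> 1"
    and "prob_space.indep_vars M (\<lambda>_. borel) \<xi> {1..D}"
    and "counting_rv M \<eta>"
    and "indep_of_family M \<eta> \<xi> {1..D}"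
    and "measure M {\<omega> \<in> space M. \<eta> \<omega> \<le> D} = 1"
    and "dist_fun M (\<xi> 1) \<in> class_C"
    and "\<And>k. k \<in> {2..D} \<Longrightarrow>
           dist_fun M (\<xi> k) \<in> class_C \<or>
           tail (dist_fun M (\<xi> k)) \<in> o[at_top](tail (dist_fun M (\<xi> 1)))"
  shows "dist_fun M (stopped_sum D \<xi> \<eta>) \<in> class_C"
proof -
  interpret prob_space M by (rule assms(1))
  have eta [measurable]: "\<eta> \<in> measurable M (count_space UNIV)"
    and eta0: "prob {\<omega> \<in> space M. \<eta> \<omega> = 0} < 1"
    using assms(4) by (auto simp: counting_rv_def)
  have rv: "random_variable borel (\<xi> k)" if "k \<in> {1..D}" for k
    using assms(3) that by (auto simp: indep_vars_def)
  have ps: "random_variable borel (partial_sum \<xi> n)" if "n \<le> D" for n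
    unfolding partial_sum_def[abs_def] using that by (intro borel_measurable_sum rv) auto
  have "(\<lambda>\<omega>. partial_sum \<xi> (min (\<eta> \<omega>) D) \<omega>) \<in> borel_measurable M"
    by (rule measurable_compose_countable[OF ps eta]) auto
  then have ss: "random_variable borel (stopped_sum D \<xi> \<eta>)"
    by (simp add: stopped_sum_def[abs_def])

  define p where "p n = prob {\<omega> \<in> space M. \<eta> \<omega> = n}" for n
  define t where "t n = tail (dist_fun M (partial_sum \<xi> n))" for n
  define T where "T = tail (dist_fun M (stopped_sum D \<xi> \<eta>))"
  have p0: "0 \<le> p n" for n by (simp add: p_def)
  have t0: "0 \<le> t n x" if "n \<le> D" for n x
    unfolding t_def using that by (intro is_dist_fun_tail is_dist_fun_dist_fun ps)
  have p_sum: "(\<Sum>n\<le>D. p n) = 1"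
  proof -
    have "(\<Sum>n\<le>D. p n) = prob (\<Union>n\<in>{..D}. {\<omega> \<in> space M. \<eta> \<omega> = n})"
      unfolding p_def
      by (intro finite_measure_finite_Union[symmetric]) (auto simp: disjoint_family_on_def)
    also have "(\<Union>n\<in>{..D}. {\<omega> \<in> space M. \<eta> \<omega> = n}) = {\<omega> \<in> space M. \<eta> \<omega> \<le> D}" by auto
    finally show ?thesis using assms(6) by simp
  qed
  have T_eq: "T x = (\<Sum>n\<le>D. p n * t n x)" for x
  proof -
    have "dist_fun M (stopped_sum D \<xi> \<eta>) x = (\<Sum>n\<le>D. p n * dist_fun M (partial_sum \<xi> n) x)"
      by (subst dist_fun_stopped_sum[OF eta rv assms(5,6)])
         (auto simp: p_def dist_fun_eq[OF ps])
    then show ?thesis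
      by (simp add: T_def t_def tail_def right_diff_distrib sum_subtractf p_sum)
  qed

  have cv_t: "consistently_varying (t n) \<and> tail (dist_fun M (\<xi> 1)) \<in> O(t n)"
    if "1 \<le> n" "n \<le> D" for n
    unfolding t_def using consistently_varying_tail_partial_sum[OF assms(3,7,8) that] by blast
  have "consistently_varying (t n)" if "n \<le> D" for n
  proof (cases "n = 0")
    case True
    have "t 0 x = 0" if "0 \<le> x" for x
      unfolding t_def using that
      by (subst tail_dist_fun_eq[OF ps]) (auto simp: partial_sum_def)
    then show ?thesis
      unfolding True
      by (intro consistently_varying_zero eventually_mono[OF eventually_ge_at_top[of 0]])
  qed (use cv_t that in auto)
  then have "consistently_varying T"
    unfolding T_eq[abs_def] using p0
    by (intro consistently_varying_sum consistently_varying_cmult) auto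

  moreover have "0 < T x" for x
  proof -
    \<comment> \<open>Since \<open>\<eta>\<close> is not degenerate at 0, some nonempty partial sum has positive weight; it is
      enough to look at its tail far out, because tails decrease.\<close>
    obtain n where n: "1 \<le> n" "n \<le> D" "0 < p n"
    proof -
      have "\<exists>n\<in>{1..D}. p n \<noteq> 0"
      proof (rule ccontr)
        assume "\<not> ?thesis"
        then have "(\<Sum>n\<le>D. p n) = (\<Sum>n\<in>{0}. p n)"
          by (intro sum.mono_neutral_right) (auto simp: Suc_le_eq)
        with p_sum eta0 show False by (simp add: p_def)
      qed
      with p0 show ?thesis by (metis that atLeastAtMost_iff less_le)
    qed
    from cv_t[OF n(1,2)] obtain c where
      "\<forall>\<^sub>F x in at_top. norm (tail (dist_fun M (\<xi> 1)) x) \<le> c * norm (t n x)"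
      by (auto elim: landau_o.bigE)
    from eventually_happens'[OF _ eventually_conj[OF this eventually_ge_at_top[of x]]] obtain z where
      z: "norm (tail (dist_fun M (\<xi> 1)) z) \<le> c * norm (t n z)" "x \<le> z"
      by auto
    have "0 < tail (dist_fun M (\<xi> 1)) z"
      using assms(7) by (simp add: class_C_iff_consistently_varying)
    with z(1) have "t n z \<noteq> 0" by auto
    with t0[OF n(2), of z] n(3) have "0 < p n * t n z" by simp
    also have "\<dots> \<le> T z"
      unfolding T_eq using n p0 t0 by (intro member_le_sum) auto
    also have "T z \<le> T x"
      using z(2) unfolding T_def by (intro antimonoD[OF is_dist_fun_tail(1)] is_dist_fun_dist_fun ss)
    finally show ?thesis .
  qed
  ultimately show ?thesis
    using is_dist_fun_dist_fun[OF ss] by (simp add: class_C_iff_consistently_varying T_def)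
qed

end
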